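(* Let $n\ge1$, let $(\xi_i)_{1\le i\le n}$ be a (possibly non-homogeneous) Markov process, and let $(X_1,X_2,\dots,X_n)$ be a vector of square integrable centered random variables that are functions of this process, i.e. $X_k=f_k(\xi_k)$ with $f_k$ real-valued and measurable. Let $S_n=\sum_{i=1}^n X_i$ and let $\rho_1$ be the maximal coefficient of correlation of $(\xi_i)_{1\le i\le n}$ defined in the context. If $\rho_1<1$, then $$\frac{1-\rho_1}{1+\rho_1}\sum_{i=1}^n\mathbf{E}X_i^2\le\mathbf{E}S_n^2\le\frac{1+\rho_1}{1-\rho_1}\sum_{i=1}^n\mathbf{E}X_i^2.$$
   Context: The process is defined on a probability space $(\Omega,\mathcal{K},\mathbf{P})$ with values in a measurable space $(\mathcal{X},\mathcal{B}(\mathcal{X}))$. For sub-$\sigma$-algebras $\mathcal{A},\mathcal{B}$ of $\mathcal{K}$, $$\rho(\mathcal{A},\mathcal{B})=\sup_{f\in \mathbf{L}_2(\mathcal{A}),\,g\in \mathbf{L}_2(\mathcal{B})}|\mathrm{corr}(f,g)|,$$ where $\mathbf{L}_2(\mathcal{A})$ is the space of square integrable $\mathcal{A}$-measurable random variables (the correlation is taken to be $0$ if one of the variables is a.s. constant). Then $\rho_1=\max_{1\le s\le n-1}\rho(\sigma(\xi_s),\sigma(\xi_{s+1}))$ (with $\rho_1=0$ if $n=1$). Equivalently, $$\rho_1=\max_{2\le i\le n}\sup_g\left\{\frac{\|\mathbf{E}(g(\xi_i)\mid\xi_{i-1})\|_2}{\|g(\xi_i)\|_2}:\ \|g(\xi_i)\|_2<\infty,\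 \mathbf{E}g(\xi_i)=0\right\},$$ with $\|X\|_2=(\mathbf{E}|X|^2)^{1/2}$ and ratios with zero denominator disregarded. *)

theory Defs
  imports "HOL-Probability.Probability"
begin

definition sq_integrable_rvs :: "'a measure \<Rightarrow> 'a measure \<Rightarrow> ('a \<Rightarrow> real) set" where
  "sq_integrable_rvs M A = {f \<in> borel_measurable A. integrable M (\<lambda>\<omega>. (f \<omega>)\<^sup>2)}"

definition covar :: "'a measure \<Rightarrow> ('a \<Rightarrow> real) \<Rightarrow> ('a \<Rightarrow> real) \<Rightarrow> real" where
  "covar M f g =
    (\<integral>\<omega>. (f \<omega> - integral\<^sup>L M f) * (g \<omega> - integral\<^sup>L M g) \<partial>M)"

text \<open>The convention \<open>x / 0 = 0\<close> makes the correlation 0 if one of the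
  two square integrable variables is almost surely constant.\<close>

definition corr :: "'a measure \<Rightarrow> ('a \<Rightarrow> real) \<Rightarrow> ('a \<Rightarrow> real) \<Rightarrow> real" where
  "corr M f g = covar M f g / sqrt (covar M f f * covar M g g)"

text \<open>For sub-\<open>\<sigma>\<close>-algebras \<open>A\<close>, \<open>B\<close> of a probability space \<open>M\<close>. The set
  contains 0 and is bounded above by 1 (Cauchy-Schwarz), so the supremum in the
  reals is the genuine one.\<close>

definition max_corr :: "'a measure \<Rightarrow> 'a measure \<Rightarrow> 'a measure \<Rightarrow> real" where
  "max_corr M A B =
    Sup {\<bar>corr M f g\<bar> | f g. f \<in> sq_integrable_rvs M A \<and> g \<in> sq_integrable_rvs M B}"

definition sigma_rv :: "'a measure \<Rightarrow> 'b measure \<Rightarrow> ('a \<Rightarrow> 'b) \<Rightarrow> 'a measure" where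
  "sigma_rv M S X = vimage_algebra (space M) X S"

definition sigma_past :: "'a measure \<Rightarrow> 'b measure \<Rightarrow> (nat \<Rightarrow> 'a \<Rightarrow> 'b) \<Rightarrow> nat \<Rightarrow> 'a measure" where
  "sigma_past M S \<xi> k = sigma (space M) (\<Union>j\<in>{1..k}. sets (sigma_rv M S (\<xi> j)))"

text \<open>The Markov property is stated through conditional probabilities, so that neither
  homogeneity nor the existence of transition kernels is assumed: almost surely
  \<open>P(\<xi>\<^bsub>k+1\<^esub> \<in> B | \<xi>\<^sub>1, \<dots>, \<xi>\<^sub>k) = P(\<xi>\<^bsub>k+1\<^esub> \<in> B | \<xi>\<^sub>k)\<close>.\<close>

definition markov_process ::
    "'a measure \<Rightarrow> 'b measure \<Rightarrow> nat \<Rightarrow> (nat \<Rightarrow> 'a \<Rightarrow> 'b) \<Rightarrow> bool" where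
  "markov_process M S n \<xi> \<longleftrightarrow>
    (\<forall>i\<in>{1..n}. \<xi> i \<in> measurable M S) \<and>
    (\<forall>k\<in>{1..<n}. \<forall>B\<in>sets S. AE \<omega> in M.
        real_cond_exp M (sigma_past M S \<xi> k) (indicator (\<xi> (k + 1) -` B \<inter> space M)) \<omega>
      = real_cond_exp M (sigma_rv M S (\<xi> k)) (indicator (\<xi> (k + 1) -` B \<inter> space M)) \<omega>)"

definition rho1 :: "'a measure \<Rightarrow> 'b measure \<Rightarrow> nat \<Rightarrow> (nat \<Rightarrow> 'a \<Rightarrow> 'b) \<Rightarrow> real" where
  "rho1 M S n \<xi> =
    (if n \<le> 1 then 0
     else Max ((\<lambda>s. max_corr M (sigma_rv M S (\<xi> s)) (sigma_rv M S (\<xi> (s + 1)))) ` {1..n - 1}))"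

end

theory Submission
  imports Defs
begin

text \<open>The Markov property gives, with \<open>V = X\<^sub>1 + \<dots> + X\<^sub>k\<close>, a centered function \<open>Y\<close> of
  \<open>\<xi>\<^bsub>k+1\<^esub>\<close> and \<open>P = E(Y | \<xi>\<^sub>k)\<close>, the identity
  \<open>E (V + Y)\<^sup>2 = E (V + P)\<^sup>2 + E Y\<^sup>2 - E P\<^sup>2\<close>, where \<open>E P\<^sup>2 \<le> \<rho>\<^sub>1\<^sup>2 E Y\<^sup>2\<close>. Since \<open>X\<^sub>k + P\<close>
  is a centered function of \<open>\<xi>\<^sub>k\<close>, this can be iterated; at each step
  the Cauchy-Schwarz inequality compares \<open>E (X\<^sub>k + P)\<^sup>2\<close> with \<open>E X\<^sub>k\<^sup>2\<close> and \<open>E Y\<^sup>2\<close>.\<close>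

section \<open>Products and sums of square integrable functions\<close>

lemma integrable_mult_sq_integrable:
  fixes f g :: "'a \<Rightarrow> real"
  assumes [measurable]: "f \<in> borel_measurable M" "g \<in> borel_measurable M"
    and "integrable M (\<lambda>x. (f x)\<^sup>2)" "integrable M (\<lambda>x. (g x)\<^sup>2)"
  shows "integrable M (\<lambda>x. f x * g x)"
proof (rule Bochner_Integration.integrable_bound)
  show "integrable M (\<lambda>x. (f x)\<^sup>2 + (g x)\<^sup>2)"
    using assms by simp
  show "AE x in M. norm (f x * g x) \<le> norm ((f x)\<^sup>2 + (g x)\<^sup>2)"
  proof (rule AE_I2)
    fix x
    have "2 * (\<bar>f x\<bar> * \<bar>g x\<bar>) \<le> (f x)\<^sup>2 + (g x)\<^sup>2"
      using sum_squares_bound[of "\<bar>f x\<bar>" "\<bar>g x\<bar>"] by simp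
    moreover have "0 \<le> \<bar>f x\<bar> * \<bar>g x\<bar>" by simp
    ultimately show "norm (f x * g x) \<le> norm ((f x)\<^sup>2 + (g x)\<^sup>2)"
      unfolding real_norm_def abs_mult by linarith
  qed
qed simp

lemma sq_integrable_add:
  fixes f g :: "'a \<Rightarrow> real"
  assumes "f \<in> borel_measurable M" "g \<in> borel_measurable M"
    and "integrable M (\<lambda>x. (f x)\<^sup>2)" "integrable M (\<lambda>x. (g x)\<^sup>2)"
  shows "integrable M (\<lambda>x. (f x + g x)\<^sup>2)"
    and "(\<integral>x. (f x + g x)\<^sup>2 \<partial>M)
      = (\<integral>x. (f x)\<^sup>2 \<partial>M) + 2 * (\<integral>x. f x * g x \<partial>M) + (\<integral>x. (g x)\<^sup>2 \<partial>M)"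
proof -
  have eq: "(f x + g x)\<^sup>2 = (f x)\<^sup>2 + 2 * (f x * g x) + (g x)\<^sup>2" for x
    by (simp add: power2_sum)
  note [simp] = integrable_mult_sq_integrable[OF assms] assms
  show "integrable M (\<lambda>x. (f x + g x)\<^sup>2)"
    unfolding eq by simp
  show "(\<integral>x. (f x + g x)\<^sup>2 \<partial>M)
      = (\<integral>x. (f x)\<^sup>2 \<partial>M) + 2 * (\<integral>x. f x * g x \<partial>M) + (\<integral>x. (g x)\<^sup>2 \<partial>M)"
    unfolding eq by simp
qed

lemma Cauchy_Schwarz_integral:
  fixes f g :: "'a \<Rightarrow> real"
  assumes [measurable]: "f \<in> borel_measurable M" "g \<in> borel_measurable M"
    and f: "integrable M (\<lambda>x. (f x)\<^sup>2)" and g: "integrable M (\<lambda>x. (g x)\<^sup>2)"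
  shows "(\<integral>x. f x * g x \<partial>M)\<^sup>2 \<le> (\<integral>x. (f x)\<^sup>2 \<partial>M) * (\<integral>x. (g x)\<^sup>2 \<partial>M)"
proof -
  define A where "A = (\<integral>x. (f x)\<^sup>2 \<partial>M)"
  define B where "B = (\<integral>x. (g x)\<^sup>2 \<partial>M)"
  define c where "c = (\<integral>x. f x * g x \<partial>M)"
  have "A \<ge> 0" unfolding A_def by simp
  show ?thesis
  proof (cases "A = 0")
    case True
    then have "AE x in M. (f x)\<^sup>2 = 0"
      unfolding A_def using integral_nonneg_eq_0_iff_AE[OF f] by simp
    then have "AE x in M. f x * g x = 0" by auto
    then have "c = 0" unfolding c_def by (rule integral_eq_zero_AE)
    then show ?thesis using True by (simp add: A_def c_def)
  next
    case False
    \<comment> \<open>\<open>A * g - c * f\<close> is \<open>A\<close> times the component of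
      \<open>g\<close> orthogonal to \<open>f\<close>; scaling by \<open>A\<close> avoids a
      division. Its squared norm is \<open>A * (A * B - c^2)\<close>.\<close>
    have "0 \<le> (\<integral>x. (A * g x + - c * f x)\<^sup>2 \<partial>M)" by simp
    also have "\<dots> = (\<integral>x. (A * g x)\<^sup>2 \<partial>M) + 2 * (\<integral>x. A * g x * (- c * f x) \<partial>M) + (\<integral>x. (- c * f x)\<^sup>2 \<partial>M)"
      using f g by (intro sq_integrable_add(2)) (auto simp: power_mult_distrib)
    also have "(\<lambda>x. A * g x * (- c * f x)) = (\<lambda>x. - (A * c) * (f x * g x))"
      by (auto simp: algebra_simps)
    also have "(\<integral>x. (A * g x)\<^sup>2 \<partial>M) + 2 * (\<integral>x. - (A * c) * (f x * g x) \<partial>M) + (\<integral>x. (- c * f x)\<^sup>2 \<partial>M)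
        = A\<^sup>2 * B + 2 * (- (A * c) * c) + c\<^sup>2 * A"
      unfolding power_mult_distrib integral_mult_right_zero A_def[symmetric] B_def[symmetric]
        c_def[symmetric] by simp
    also have "\<dots> = A * (A * B - c\<^sup>2)"
      by (simp add: power2_eq_square algebra_simps)
    finally have "0 \<le> A * B - c\<^sup>2"
      using False \<open>A \<ge> 0\<close> by (simp add: zero_le_mult_iff)
    then show ?thesis by (simp add: A_def B_def c_def)
  qed
qed

section \<open>Conditional expectation and conditional independence\<close>

text \<open>Jensen's inequality for conditional expectations, applied to the convex function
  \<open>x^2\<close>.\<close>

lemma (in prob_space) sq_integrable_real_cond_exp:
  assumes F: "subalgebra M F"
    and Y[measurable]: "Y \<in> borel_measurable M" and Y2: "integrable M (\<lambda>x. (Y x)\<^sup>2)"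
  shows "integrable M (\<lambda>x. (real_cond_exp M F Y x)\<^sup>2)"
proof -
  interpret F: finite_measure_subalgebra M F by unfold_locales (rule F)
  have "integrable M Y" by (rule square_integrable_imp_integrable[OF Y Y2])
  then show ?thesis
    by (rule F.integrable_convex_cond_exp[where q = "\<lambda>x. x\<^sup>2" and I = UNIV])
       (auto simp: Y2 convex_power2)
qed

text \<open>The hypothesis says that \<open>F\<close> and \<open>H\<close> are conditionally independent given \<open>G\<close>. Testing
  \<open>Y\<close> against \<open>A \<in> sets F\<close> and moving \<open>E( _ | G)\<close> over to the bounded factor \<open>indicator A\<close>
  avoids approximating \<open>Y\<close> by simple functions.\<close>

lemma (in prob_space) real_cond_exp_eq_of_indicators:
  assumes F: "subalgebra M F" and GF: "subalgebra F G" and H: "subalgebra M H"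
    and ind: "\<And>B. B \<in> sets H \<Longrightarrow>
      AE x in M. real_cond_exp M F (indicator B) x = real_cond_exp M G (indicator B) x"
    and YH[measurable]: "Y \<in> borel_measurable H" and Y: "integrable M Y"
  shows "AE x in M. real_cond_exp M F Y x = real_cond_exp M G Y x"
proof -
  have G: "subalgebra M G"
    using F GF by (auto simp: subalgebra_def)
  interpret F: finite_measure_subalgebra M F by unfold_locales (rule F)
  interpret G: finite_measure_subalgebra M G by unfold_locales (rule G)
  interpret H: finite_measure_subalgebra M H by unfold_locales (rule H)
  have GmF: "f \<in> borel_measurable F" if "f \<in> borel_measurable G" for f :: "'a \<Rightarrow> real"
    using that by (rule measurable_from_subalg[OF GF])
  have YM[measurable]: "Y \<in> borel_measurable M" using Y by auto
  \<comment> \<open>All products below have one factor bounded by 1 almost everywhere, so this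
    supplies their integrability although \<open>Y\<close> is only integrable.\<close>
  have int_bdd: "integrable M (\<lambda>x. f x * g x)" if "integrable M f" "g \<in> borel_measurable M"
      "AE x in M. \<bar>g x\<bar> \<le> 1" for f g :: "'a \<Rightarrow> real"
  proof (rule Bochner_Integration.integrable_bound[OF that(1)])
    show "AE x in M. norm (f x * g x) \<le> norm (f x)"
      using that(3) by eventually_elim (simp add: abs_mult mult_left_le)
  qed (use that in measurable)
  show ?thesis
  proof (rule F.real_cond_exp_charact)
    show "integrable M Y" by (rule Y)
    show "integrable M (real_cond_exp M G Y)" by (rule G.real_cond_exp_int(1)[OF Y])
    show "real_cond_exp M G Y \<in> borel_measurable F" by (intro GmF) simp
    fix A assume AF: "A \<in> sets F"
    then have [measurable]: "A \<in> sets M" using F by (auto simp: subalgebra_def)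
    have [measurable]: "(indicator A :: 'a \<Rightarrow> real) \<in> borel_measurable F" using AF by simp
    define a where "a = (indicator A :: 'a \<Rightarrow> real)"
    define aG where "aG = real_cond_exp M G a"
    have a: "integrable M a" and [measurable]: "a \<in> borel_measurable M" "a \<in> borel_measurable F"
      by (auto simp: a_def less_top[symmetric])
    have a1: "AE x in M. \<bar>a x\<bar> \<le> 1" by (auto simp: a_def indicator_def)
    have [measurable]: "aG \<in> borel_measurable G" "aG \<in> borel_measurable M"
      by (simp_all add: aG_def)
    have aG: "integrable M aG" unfolding aG_def by (rule G.real_cond_exp_int(1)[OF a])
    have "AE x in M. aG x \<ge> 0" unfolding aG_def
      by (rule G.real_cond_exp_pos) (auto simp: a_def)
    moreover have "AE x in M. aG x \<le> 1" unfolding aG_def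
      by (rule G.real_cond_exp_le_c[OF a]) (auto simp: a_def indicator_def)
    ultimately have aG1: "AE x in M. \<bar>aG x\<bar> \<le> 1" by eventually_elim simp
    \<comment> \<open>Conditional independence read the other way: E(a | H) = E(E(a | G) | H). Only
      sets \<open>B\<close> of \<open>H\<close> are tested, and these are the sets covered by
      \<open>ind\<close>.\<close>
    have "AE x in M. real_cond_exp M H a x = real_cond_exp M H aG x"
    proof (rule H.real_cond_exp_charact[OF _ a])
      show "integrable M (real_cond_exp M H aG)" by (rule H.real_cond_exp_int(1)[OF aG])
      fix B assume B: "B \<in> sets H"
      then have BM[measurable]: "B \<in> sets M" using H by (auto simp: subalgebra_def)
      define b where "b = (indicator B :: 'a \<Rightarrow> real)"
      have [measurable]: "b \<in> borel_measurable M" and b: "integrable M b"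
        by (auto simp: b_def less_top[symmetric])
      have "(\<integral>x\<in>B. real_cond_exp M H aG x \<partial>M) = (\<integral>x\<in>B. aG x \<partial>M)"
        by (rule H.real_cond_exp_intA[OF aG B, symmetric])
      also have "\<dots> = (\<integral>x. aG x * b x \<partial>M)"
        by (simp add: set_lebesgue_integral_def b_def mult.commute)
      \<comment> \<open>E( . | G) is self-adjoint: this equality and the next one move it from
        \<open>a\<close> to \<open>b\<close>.\<close>
      also have "\<dots> = (\<integral>x. aG x * real_cond_exp M G b x \<partial>M)"
        using int_bdd[OF b _ aG1]
        by (intro G.real_cond_exp_intg(2)[symmetric]) (simp_all add: mult.commute)
      also have "\<dots> = (\<integral>x. real_cond_exp M G b x * a x \<partial>M)"
        using int_bdd[OF G.real_cond_exp_int(1)[OF b] _ a1] unfolding aG_def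
        by (subst G.real_cond_exp_intg(2)[symmetric]) (simp_all add: mult.commute)
      also have "\<dots> = (\<integral>x. a x * real_cond_exp M F b x \<partial>M)"
        using ind[OF B] by (intro integral_cong_AE) (auto simp: b_def)
      also have "\<dots> = (\<integral>x. a x * b x \<partial>M)"
        using int_bdd[OF b _ a1]
        by (intro F.real_cond_exp_intg(2)) (simp_all add: mult.commute)
      also have "\<dots> = (\<integral>x\<in>B. a x \<partial>M)"
        by (simp add: set_lebesgue_integral_def b_def mult.commute)
      finally show "(\<integral>x\<in>B. a x \<partial>M) = (\<integral>x\<in>B. real_cond_exp M H aG x \<partial>M)" ..
    qed simp
    then have HaG: "(\<integral>x. Y x * real_cond_exp M H a x \<partial>M) = (\<integral>x. Y x * real_cond_exp M H aG x \<partial>M)"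
      by (intro integral_cong_AE) auto
    have "(\<integral>x\<in>A. Y x \<partial>M) = (\<integral>x. Y x * a x \<partial>M)"
      by (simp add: set_lebesgue_integral_def a_def mult.commute)
    \<comment> \<open>As \<open>Y\<close> is \<open>H\<close>-measurable, \<open>a\<close> and
      \<open>aG\<close> may each be exchanged for their conditional expectations given
      \<open>H\<close>, which agree. Self-adjointness of E( . | G) then carries the projection from
      \<open>a\<close> to \<open>Y\<close>.\<close>
    also have "\<dots> = (\<integral>x. Y x * real_cond_exp M H a x \<partial>M)"
      by (rule H.real_cond_exp_intg(2)[symmetric]) (simp_all add: int_bdd Y a1)
    also have "\<dots> = (\<integral>x. Y x * aG x \<partial>M)"
      unfolding HaG by (rule H.real_cond_exp_intg(2)) (simp_all add: int_bdd Y aG1)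
    also have "\<dots> = (\<integral>x. aG x * real_cond_exp M G Y x \<partial>M)"
      using int_bdd[OF Y _ aG1]
      by (subst G.real_cond_exp_intg(2)) (simp_all add: mult.commute)
    also have "\<dots> = (\<integral>x. real_cond_exp M G Y x * a x \<partial>M)"
      using int_bdd[OF G.real_cond_exp_int(1)[OF Y] _ a1] unfolding aG_def
      by (subst G.real_cond_exp_intg(2)[symmetric]) (simp_all add: mult.commute)
    also have "\<dots> = (\<integral>x\<in>A. real_cond_exp M G Y x \<partial>M)"
      by (simp add: set_lebesgue_integral_def a_def mult.commute)
    finally show "(\<integral>x\<in>A. Y x \<partial>M) = (\<integral>x\<in>A. real_cond_exp M G Y x \<partial>M)" .
  qed
qed

section \<open>Square integrable variables over a sub-sigma-algebra and maximal correlation\<close>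

lemma sq_integrable_rvsD:
  assumes "f \<in> sq_integrable_rvs M A" "subalgebra M A"
  shows "f \<in> borel_measurable A" "f \<in> borel_measurable M" "integrable M (\<lambda>x. (f x)\<^sup>2)"
  using assms by (auto simp: sq_integrable_rvs_def intro: measurable_from_subalg)

lemma sq_integrable_rvs_add:
  assumes "f \<in> sq_integrable_rvs M A" "g \<in> sq_integrable_rvs M A" "subalgebra M A"
  shows "(\<lambda>x. f x + g x) \<in> sq_integrable_rvs M A"
  using sq_integrable_rvsD[OF assms(1,3)] sq_integrable_rvsD[OF assms(2,3)]
  by (auto simp: sq_integrable_rvs_def intro: sq_integrable_add(1))

lemma sq_integrable_rvs_sum:
  assumes "\<And>i. i \<in> I \<Longrightarrow> f i \<in> sq_integrable_rvs M A" "subalgebra M A"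
  shows "(\<lambda>x. \<Sum>i\<in>I. f i x) \<in> sq_integrable_rvs M A"
  using assms(1)
proof (induction I rule: infinite_finite_induct)
  case (insert i I)
  then show ?case by (simp add: sq_integrable_rvs_add assms(2))
qed (simp_all add: sq_integrable_rvs_def)

lemma (in prob_space) sq_integrable_rvs_cond_exp:
  assumes "Y \<in> sq_integrable_rvs M H" "subalgebra M H" "subalgebra M G"
  shows "real_cond_exp M G Y \<in> sq_integrable_rvs M G"
  using sq_integrable_real_cond_exp[OF assms(3) sq_integrable_rvsD(2,3)[OF assms(1,2)]]
  by (simp add: sq_integrable_rvs_def)

text \<open>Cauchy-Schwarz for the centered variables. This bounds the set in
  \<open>max_corr\<close>, so that its \<open>Sup\<close> really is an upper bound.\<close>

lemma (in prob_space) abs_corr_le_1: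
  assumes [measurable]: "f \<in> borel_measurable M" "g \<in> borel_measurable M"
    and f: "integrable M (\<lambda>x. (f x)\<^sup>2)" and g: "integrable M (\<lambda>x. (g x)\<^sup>2)"
  shows "\<bar>corr M f g\<bar> \<le> 1"
proof -
  have sq: "integrable M (\<lambda>x. (h x - integral\<^sup>L M h)\<^sup>2)"
    if "h \<in> borel_measurable M" "integrable M (\<lambda>x. (h x)\<^sup>2)" for h :: "'a \<Rightarrow> real"
    using sq_integrable_add(1)[OF that(1) _ that(2), of "\<lambda>_. - integral\<^sup>L M h"] by simp
  have "(covar M f g)\<^sup>2 \<le> covar M f f * covar M g g"
    using Cauchy_Schwarz_integral[OF _ _ sq[OF _ f] sq[OF _ g]]
    by (simp add: covar_def power2_eq_square)
  then have "\<bar>covar M f g\<bar> \<le> sqrt (covar M f f * covar M g g)"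
    by (rule real_le_rsqrt[of "\<bar>covar M f g\<bar>", simplified])
  then show ?thesis
    by (auto simp: corr_def divide_le_eq_1)
qed

lemma (in prob_space) abs_corr_le_max_corr:
  assumes f: "f \<in> sq_integrable_rvs M A" and g: "g \<in> sq_integrable_rvs M B"
    and A: "subalgebra M A" and B: "subalgebra M B"
  shows "\<bar>corr M f g\<bar> \<le> max_corr M A B"
  unfolding max_corr_def
proof (rule cSup_upper)
  show "bdd_above {\<bar>corr M f g\<bar> |f g. f \<in> sq_integrable_rvs M A \<and> g \<in> sq_integrable_rvs M B}"
    using A B by (auto intro!: bdd_aboveI[of _ 1] abs_corr_le_1 dest: sq_integrable_rvsD)
qed (use f g in auto)

lemma (in prob_space) max_corr_nonneg:
  assumes "subalgebra M A" "subalgebra M B"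
  shows "0 \<le> max_corr M A B"
proof -
  have "(\<lambda>_. 0) \<in> sq_integrable_rvs M A" "(\<lambda>_. 0) \<in> sq_integrable_rvs M B"
    by (auto simp: sq_integrable_rvs_def)
  from abs_corr_le_max_corr[OF this assms] show ?thesis
    by (simp add: corr_def covar_def)
qed

lemma (in prob_space) integral_mult_le_max_corr:
  assumes f: "f \<in> sq_integrable_rvs M A" and g: "g \<in> sq_integrable_rvs M B"
    and A: "subalgebra M A" and B: "subalgebra M B"
    and f0: "integral\<^sup>L M f = 0" and g0: "integral\<^sup>L M g = 0"
  shows "\<bar>\<integral>x. f x * g x \<partial>M\<bar>
    \<le> max_corr M A B * sqrt ((\<integral>x. (f x)\<^sup>2 \<partial>M) * (\<integral>x. (g x)\<^sup>2 \<partial>M))"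
    (is "\<bar>?c\<bar> \<le> _ * sqrt ?d")
proof (cases "?d = 0")
  \<comment> \<open>Here \<open>corr\<close> is 0 only by the convention for division by zero and
    says nothing about the integral; Cauchy-Schwarz makes the integral vanish.\<close>
  case True
  then show ?thesis
    using Cauchy_Schwarz_integral[OF sq_integrable_rvsD(2)[OF f A] sq_integrable_rvsD(2)[OF g B]
      sq_integrable_rvsD(3)[OF f A] sq_integrable_rvsD(3)[OF g B]] by auto
next
  case False
  moreover have "?d \<ge> 0" by simp
  ultimately have "?d > 0" by linarith
  then have "sqrt ?d > 0" by (rule real_sqrt_gt_zero)
  moreover have "\<bar>?c / sqrt ?d\<bar> \<le> max_corr M A B"
    using abs_corr_le_max_corr[OF f g A B]
    by (simp add: corr_def covar_def f0 g0 flip: power2_eq_square)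
  ultimately show ?thesis
    by (simp add: abs_divide pos_divide_le_eq)
qed

section \<open>Contraction and splitting by conditional expectation\<close>

text \<open>\<open>P\<close> is the orthogonal projection of \<open>Y\<close> onto the
  \<open>G\<close>-measurable variables, so E P^2 = E(P Y). Maximal correlation bounds this by a
  multiple of the product of the two norms, and one factor, the norm of \<open>P\<close>,
  cancels.\<close>

lemma (in prob_space) cond_exp_max_corr_contraction:
  assumes Y: "Y \<in> sq_integrable_rvs M H" and H: "subalgebra M H" and G: "subalgebra M G"
    and Y0: "integral\<^sup>L M Y = 0"
  shows "(\<integral>x. (real_cond_exp M G Y x)\<^sup>2 \<partial>M) \<le> (max_corr M G H)\<^sup>2 * (\<integral>x. (Y x)\<^sup>2 \<partial>M)"
proof -
  interpret G: finite_measure_subalgebra M G by unfold_locales (rule G)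
  define P where "P = real_cond_exp M G Y"
  note Y' = sq_integrable_rvsD[OF Y H]
  have P: "P \<in> sq_integrable_rvs M G"
    unfolding P_def by (rule sq_integrable_rvs_cond_exp[OF Y H G])
  note P' = sq_integrable_rvsD[OF P G]
  have P0: "integral\<^sup>L M P = 0"
    unfolding P_def using G.real_cond_exp_int(2)[OF square_integrable_imp_integrable[OF Y'(2,3)]] Y0
    by simp
  define p where "p = (\<integral>x. (P x)\<^sup>2 \<partial>M)"
  define y where "y = (\<integral>x. (Y x)\<^sup>2 \<partial>M)"
  have "p \<ge> 0" "y \<ge> 0" by (simp_all add: p_def y_def)
  have "p = (\<integral>x. P x * Y x \<partial>M)"
    unfolding p_def power2_eq_square
    using G.real_cond_exp_intg(2)[OF integrable_mult_sq_integrable[OF P'(2) Y'(2) P'(3) Y'(3)] P'(1) Y'(2)]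
    by (simp add: P_def)
  also have "\<dots> \<le> max_corr M G H * sqrt (p * y)"
    using integral_mult_le_max_corr[OF P Y G H P0 Y0] by (simp add: p_def y_def)
  finally have "p\<^sup>2 \<le> (max_corr M G H * sqrt (p * y))\<^sup>2"
    using \<open>p \<ge> 0\<close> by (rule power_mono)
  also have "\<dots> = (max_corr M G H)\<^sup>2 * (p * y)"
    using \<open>p \<ge> 0\<close> \<open>y \<ge> 0\<close> by (simp add: power_mult_distrib)
  finally have "p * p \<le> p * ((max_corr M G H)\<^sup>2 * y)"
    by (simp add: power2_eq_square ac_simps)
  then have "p \<le> (max_corr M G H)\<^sup>2 * y"
    using \<open>p \<ge> 0\<close> \<open>y \<ge> 0\<close> by (cases "p = 0") simp_all
  then show ?thesis by (simp add: p_def y_def P_def)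
qed

text \<open>Since \<open>V\<close> is \<open>F\<close>-measurable, E(V Y) = E(V E(Y | F)), and
  conditional independence turns this into E(V E(Y | G)). The cross terms of the two squares
  therefore coincide.\<close>

lemma (in prob_space) second_moment_cond_exp_split:
  assumes F: "subalgebra M F" and GF: "subalgebra F G" and H: "subalgebra M H"
    and ind: "\<And>B. B \<in> sets H \<Longrightarrow>
      AE x in M. real_cond_exp M F (indicator B) x = real_cond_exp M G (indicator B) x"
    and V: "V \<in> sq_integrable_rvs M F" and Y: "Y \<in> sq_integrable_rvs M H"
  shows "(\<integral>x. (V x + Y x)\<^sup>2 \<partial>M) = (\<integral>x. (V x + real_cond_exp M G Y x)\<^sup>2 \<partial>M)
    + (\<integral>x. (Y x)\<^sup>2 \<partial>M) - (\<integral>x. (real_cond_exp M G Y x)\<^sup>2 \<partial>M)"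
proof -
  have G: "subalgebra M G"
    using F GF by (auto simp: subalgebra_def)
  interpret F: finite_measure_subalgebra M F by unfold_locales (rule F)
  note V' = sq_integrable_rvsD[OF V F] and Y' = sq_integrable_rvsD[OF Y H]
    and P' = sq_integrable_rvsD[OF sq_integrable_rvs_cond_exp[OF Y H G] G]
  note [measurable] = V'(2)
  have "AE x in M. real_cond_exp M F Y x = real_cond_exp M G Y x"
    using real_cond_exp_eq_of_indicators[OF F GF H ind Y'(1) square_integrable_imp_integrable[OF Y'(2,3)]] .
  then have "(\<integral>x. V x * real_cond_exp M F Y x \<partial>M) = (\<integral>x. V x * real_cond_exp M G Y x \<partial>M)"
    by (intro integral_cong_AE) auto
  then have "(\<integral>x. V x * Y x \<partial>M) = (\<integral>x. V x * real_cond_exp M G Y x \<partial>M)"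
    using F.real_cond_exp_intg(2)[OF integrable_mult_sq_integrable[OF V'(2) Y'(2) V'(3) Y'(3)] V'(1) Y'(2)]
    by simp
  then show ?thesis
    using sq_integrable_add(2)[OF V'(2) Y'(2) V'(3) Y'(3)]
      sq_integrable_add(2)[OF V'(2) P'(2) V'(3) P'(3)] by simp
qed

section \<open>Scalar inequalities for one induction step\<close>

text \<open>AM-GM for \<open>A / s\<close> and \<open>s * y\<close>, whose product does not depend
  on \<open>s\<close>. The lower bound below takes \<open>s = 1\<close>, the upper bound
  \<open>s = 1 - r\<close>.\<close>

lemma weighted_AM_GM_correlation:
  fixes A B c r s y :: real
  assumes "c\<^sup>2 \<le> A * B" "B \<le> r\<^sup>2 * y" "A \<ge> 0" "y \<ge> 0" "r \<ge> 0" "s > 0"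
  shows "2 * \<bar>c\<bar> \<le> r * (A / s + s * y)"
proof -
  have "c\<^sup>2 \<le> A * (r\<^sup>2 * y)"
    using assms by (meson mult_left_mono order_trans)
  also have "\<dots> = r\<^sup>2 * ((A / s) * (s * y))" using assms by simp
  finally have "\<bar>c\<bar> \<le> sqrt (r\<^sup>2 * ((A / s) * (s * y)))"
    by (metis real_sqrt_abs real_sqrt_le_iff)
  also have "\<dots> = r * sqrt ((A / s) * (s * y))"
    using \<open>r \<ge> 0\<close> by (simp only: real_sqrt_mult real_sqrt_abs abs_of_nonneg)
  also have "\<dots> \<le> r * ((A / s + s * y) / 2)"
    using assms by (intro mult_left_mono arith_geo_mean_sqrt) auto
  finally show ?thesis by simp
qed

text \<open>To be read with \<open>x\<close> = E X^2, \<open>p\<close> = E P^2, \<open>c\<close> =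
  E(X P), \<open>y\<close> = E Y^2 and \<open>t\<close> = E T^2 for T = X + P. The term
  \<open>y - p\<close> is what is lost when \<open>Y\<close> is replaced by its projection
  \<open>P\<close>.\<close>

lemma potential_step:
  fixes x p y c r :: real
  assumes cs: "c\<^sup>2 \<le> x * p" and p: "p \<le> r\<^sup>2 * y"
    and nonneg: "0 \<le> x" "0 \<le> p" "0 \<le> y" "0 \<le> r" and "r < 1"
  defines "t \<equiv> x + 2 * c + p"
  shows "(1 - r) / (1 + r) * x + (1 - r) * y \<le> (1 - r) * t + y - p"
    and "(1 + r) * t + y - p \<le> (1 + r) / (1 - r) * x + (1 + r) * y"
proof -
  have rp: "1 + r > 0" "1 - r > 0" using nonneg \<open>r < 1\<close> by auto
  have "2 * \<bar>c\<bar> \<le> x + p"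
    using weighted_AM_GM_correlation[of c x p 1 p 1] cs nonneg by simp
  then have "t \<ge> 0" by (simp add: t_def)
  \<comment> \<open>\<open>c + p\<close> is E(T P), so this is Cauchy-Schwarz for T and P. Writing X
    = T - P then bounds \<open>x\<close> in terms of \<open>t\<close> and \<open>y\<close>.\<close>
  have "(c + p)\<^sup>2 \<le> t * p"
    using cs by (simp add: t_def power2_eq_square algebra_simps)
  then have "2 * \<bar>c + p\<bar> \<le> r * (t + y)"
    using weighted_AM_GM_correlation[of "c + p" t p r y 1] p nonneg \<open>t \<ge> 0\<close> by simp
  then have "- 2 * (c + p) \<le> r * (t + y)"
    using abs_ge_minus_self[of "c + p"] by simp
  then have "t + - 2 * (c + p) + p \<le> t + r * (t + y) + r\<^sup>2 * y"
    using p by (intro add_mono order_refl)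
  then have "x \<le> t + r * (t + y) + r\<^sup>2 * y"
    by (simp add: t_def)
  also have "\<dots> = (1 + r) * (t + r * y)"
    by (simp add: power2_eq_square algebra_simps)
  finally have "(1 - r) / (1 + r) * x \<le> (1 - r) / (1 + r) * ((1 + r) * (t + r * y))"
    using rp by (intro mult_left_mono) auto
  also have "\<dots> = (1 - r) * (t + r * y)" using rp by simp
  finally show "(1 - r) / (1 + r) * x + (1 - r) * y \<le> (1 - r) * t + y - p"
    using p by (simp add: power2_eq_square algebra_simps)
  \<comment> \<open>With weight \<open>1 - r\<close> the terms in \<open>y\<close> add up exactly:
    \<open>(1 + r) * r * (1 - r) + r^3 + 1 = 1 + r\<close>.\<close>
  have "2 * c \<le> r * (x / (1 - r) + (1 - r) * y)"
    using weighted_AM_GM_correlation[OF cs p, of "1 - r"] nonneg rp by linarith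
  then have "(1 + r) * (2 * c) \<le> (1 + r) * (r * (x / (1 - r) + (1 - r) * y))"
    using rp by (intro mult_left_mono) auto
  moreover have "r * p \<le> r * (r\<^sup>2 * y)"
    using p nonneg by (intro mult_left_mono) auto
  moreover have "(1 + r) * x + (1 + r) * (r * (x / (1 - r))) = (1 + r) / (1 - r) * x"
    using rp by (simp add: field_simps)
  ultimately show "(1 + r) * t + y - p \<le> (1 + r) / (1 - r) * x + (1 + r) * y"
    by (simp add: t_def power2_eq_square algebra_simps)
qed

section \<open>Sigma-algebras generated by the process\<close>

lemma space_sigma_rv [simp]: "space (sigma_rv M S \<xi>) = space M"
  by (simp add: sigma_rv_def)

lemma subalgebra_sigma_rv:
  assumes "\<xi> \<in> measurable M S"
  shows "subalgebra M (sigma_rv M S \<xi>)"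
proof -
  have "\<xi> \<in> space M \<rightarrow> space S" using assms by (auto dest: measurable_space)
  then show ?thesis
    using assms unfolding subalgebra_def sigma_rv_def
    by (auto simp: sets_vimage_algebra2 intro: measurable_sets)
qed

lemma measurable_sigma_rv:
  assumes "\<xi> \<in> measurable M S"
  shows "\<xi> \<in> measurable (sigma_rv M S \<xi>) S"
  unfolding sigma_rv_def using assms
  by (intro measurable_vimage_algebra1) (auto dest: measurable_space)

lemma space_sigma_past [simp]: "space (sigma_past M S \<xi> k) = space M"
  by (simp add: sigma_past_def space_measure_of_conv)

lemma sets_sigma_past:
  "sets (sigma_past M S \<xi> k) = sigma_sets (space M) (\<Union>j\<in>{1..k}. sets (sigma_rv M S (\<xi> j)))"
  unfolding sigma_past_def
  by (rule sets_measure_of) (use sets.sets_into_space in fastforce)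

lemma subalgebra_sigma_past_rv:
  assumes "j \<in> {1..k}"
  shows "subalgebra (sigma_past M S \<xi> k) (sigma_rv M S (\<xi> j))"
proof -
  have "sets (sigma_rv M S (\<xi> j)) \<subseteq> (\<Union>j\<in>{1..k}. sets (sigma_rv M S (\<xi> j)))"
    using assms by (rule UN_upper)
  also have "\<dots> \<subseteq> sets (sigma_past M S \<xi> k)"
    unfolding sets_sigma_past by (rule sigma_sets_superset_generator)
  finally show ?thesis by (simp add: subalgebra_def)
qed

lemma subalgebra_sigma_past:
  assumes "\<And>j. j \<in> {1..k} \<Longrightarrow> \<xi> j \<in> measurable M S"
  shows "subalgebra M (sigma_past M S \<xi> k)"
proof -
  have "sets (sigma_rv M S (\<xi> j)) \<subseteq> sets M" if "j \<in> {1..k}" for j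
    using subalgebra_sigma_rv[OF assms[OF that]] by (simp add: subalgebra_def)
  then show ?thesis
    unfolding subalgebra_def sets_sigma_past
    by (intro conjI sets.sigma_sets_subset UN_least) simp_all
qed

lemma sq_integrable_rvs_mono:
  assumes "f \<in> sq_integrable_rvs M A" "subalgebra B A"
  shows "f \<in> sq_integrable_rvs M B"
  using assms by (auto simp: sq_integrable_rvs_def intro: measurable_from_subalg)

section \<open>Induction along the process and the two-sided bound\<close>

text \<open>Passing from \<open>k\<close> to \<open>k + 1\<close>, the Markov property replaces the last summand \<open>Y\<close> by
  \<open>X (k + 1) + E(Y | \<xi> (k + 1))\<close>. The weights \<open>1 - r\<close> and \<open>1 + r\<close> of \<open>E Y\<^sup>2\<close>
  are the ones that this step reproduces.\<close>

lemma (in prob_space) markov_second_moment_bounds: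
  assumes markov: "markov_process M S n \<xi>"
    and X: "\<And>k. k \<in> {1..n} \<Longrightarrow> X k \<in> sq_integrable_rvs M (sigma_rv M S (\<xi> k))"
    and X0: "\<And>k. k \<in> {1..n} \<Longrightarrow> integral\<^sup>L M (X k) = 0"
    and corr: "\<And>k. k \<in> {1..<n} \<Longrightarrow>
      max_corr M (sigma_rv M S (\<xi> k)) (sigma_rv M S (\<xi> (k + 1))) \<le> r"
    and r: "0 \<le> r" "r < 1"
    and "k < n" "Y \<in> sq_integrable_rvs M (sigma_rv M S (\<xi> (Suc k)))" "integral\<^sup>L M Y = 0"
  shows "(1 - r) / (1 + r) * (\<Sum>i=1..k. \<integral>x. (X i x)\<^sup>2 \<partial>M) + (1 - r) * (\<integral>x. (Y x)\<^sup>2 \<partial>M)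
      \<le> (\<integral>x. ((\<Sum>i=1..k. X i x) + Y x)\<^sup>2 \<partial>M)
    \<and> (\<integral>x. ((\<Sum>i=1..k. X i x) + Y x)\<^sup>2 \<partial>M)
      \<le> (1 + r) / (1 - r) * (\<Sum>i=1..k. \<integral>x. (X i x)\<^sup>2 \<partial>M) + (1 + r) * (\<integral>x. (Y x)\<^sup>2 \<partial>M)"
  using assms(7-9)
proof (induction k arbitrary: Y)
  case 0
  have "(1 - r) * (\<integral>x. (Y x)\<^sup>2 \<partial>M) \<le> 1 * (\<integral>x. (Y x)\<^sup>2 \<partial>M)"
    "1 * (\<integral>x. (Y x)\<^sup>2 \<partial>M) \<le> (1 + r) * (\<integral>x. (Y x)\<^sup>2 \<partial>M)"
    using r by (intro mult_right_mono; simp)+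
  then show ?case by simp
next
  case (Suc k)
  define F where "F = sigma_past M S \<xi> (Suc k)"
  define G where "G = sigma_rv M S (\<xi> (Suc k))"
  define H where "H = sigma_rv M S (\<xi> (Suc (Suc k)))"
  have \<xi>: "\<xi> j \<in> measurable M S" if "j \<in> {1..n}" for j
    using markov that by (auto simp: markov_process_def)
  have F: "subalgebra M F" unfolding F_def
    using Suc.prems(1) by (intro subalgebra_sigma_past \<xi>) auto
  have GF: "subalgebra F G" unfolding F_def G_def by (rule subalgebra_sigma_past_rv) simp
  have G: "subalgebra M G" and H: "subalgebra M H" unfolding G_def H_def
    using Suc.prems(1) by (auto intro!: subalgebra_sigma_rv \<xi>)
  interpret G: finite_measure_subalgebra M G by unfold_locales (rule G)
  \<comment> \<open>Every set of \<open>H\<close> is a preimage under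
    \<open>\<xi> (Suc (Suc k))\<close>, so this is the Markov property at time \<open>Suc k\<close>,
    available because \<open>Suc k < n\<close>.\<close>
  have ind: "AE x in M. real_cond_exp M F (indicator B) x = real_cond_exp M G (indicator B) x"
    if B: "B \<in> sets H" for B
  proof -
    have "\<xi> (Suc (Suc k)) \<in> space M \<rightarrow> space S"
      using \<xi>[of "Suc (Suc k)"] Suc.prems(1) by (auto dest: measurable_space)
    then obtain C where "C \<in> sets S" "B = \<xi> (Suc (Suc k)) -` C \<inter> space M"
      using B unfolding H_def sigma_rv_def by (auto simp: sets_vimage_algebra2)
    then show ?thesis
      using markov Suc.prems(1) unfolding markov_process_def F_def G_def
      by (auto dest!: bspec[of _ _ "Suc k"])
  qed
  have Y: "Y \<in> sq_integrable_rvs M H" using Suc.prems by (simp add: H_def)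
  define P where "P = real_cond_exp M G Y"
  define T where "T = (\<lambda>x. X (Suc k) x + P x)"
  have P: "P \<in> sq_integrable_rvs M G"
    unfolding P_def by (rule sq_integrable_rvs_cond_exp[OF Y H G])
  have XG: "X (Suc k) \<in> sq_integrable_rvs M G"
    unfolding G_def using Suc.prems(1) by (intro X) simp
  have T: "T \<in> sq_integrable_rvs M G"
    unfolding T_def by (rule sq_integrable_rvs_add[OF XG P G])
  note X' = sq_integrable_rvsD[OF XG G] and Y' = sq_integrable_rvsD[OF Y H]
    and P' = sq_integrable_rvsD[OF P G]
  have "integral\<^sup>L M P = 0"
    unfolding P_def using G.real_cond_exp_int(2)[OF square_integrable_imp_integrable[OF Y'(2,3)]]
      Suc.prems(3) by simp
  \<comment> \<open>\<open>T\<close> is now a centered square integrable function of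
    \<open>\<xi> (Suc k)\<close>, so it can take the place of \<open>Y\<close> in the induction
    hypothesis.\<close>
  then have T0: "integral\<^sup>L M T = 0"
    unfolding T_def using X0[of "Suc k"] Suc.prems(1)
      square_integrable_imp_integrable[OF X'(2,3)] square_integrable_imp_integrable[OF P'(2,3)]
    by simp
  define V where "V = (\<lambda>x. \<Sum>i=1..Suc k. X i x)"
  have V: "V \<in> sq_integrable_rvs M F"
    unfolding V_def
  proof (rule sq_integrable_rvs_sum[OF _ F])
    fix i assume "i \<in> {1..Suc k}"
    then show "X i \<in> sq_integrable_rvs M F"
      unfolding F_def using Suc.prems(1)
      by (intro sq_integrable_rvs_mono[OF X subalgebra_sigma_past_rv]) auto
  qed
  define x where "x = (\<integral>x. (X (Suc k) x)\<^sup>2 \<partial>M)"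
  define y where "y = (\<integral>x. (Y x)\<^sup>2 \<partial>M)"
  define p where "p = (\<integral>x. (P x)\<^sup>2 \<partial>M)"
  define c where "c = (\<integral>x. X (Suc k) x * P x \<partial>M)"
  define w where "w = (\<integral>x. ((\<Sum>i=1..k. X i x) + T x)\<^sup>2 \<partial>M)"
  have t: "(\<integral>x. (T x)\<^sup>2 \<partial>M) = x + 2 * c + p"
    unfolding T_def x_def c_def p_def by (rule sq_integrable_add(2)[OF X'(2) P'(2) X'(3) P'(3)])
  have "(max_corr M G H)\<^sup>2 \<le> r\<^sup>2"
    using corr[of "Suc k"] Suc.prems(1) max_corr_nonneg[OF G H]
    by (intro power_mono) (auto simp: G_def H_def)
  then have "p \<le> r\<^sup>2 * y"
    unfolding p_def y_def P_def
    by (intro order_trans[OF cond_exp_max_corr_contraction[OF Y H G Suc.prems(3)]] mult_right_mono)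
       simp_all
  moreover have "c\<^sup>2 \<le> x * p"
    unfolding x_def c_def p_def by (rule Cauchy_Schwarz_integral[OF X'(2) P'(2) X'(3) P'(3)])
  moreover have "0 \<le> x" "0 \<le> p" "0 \<le> y" by (simp_all add: x_def p_def y_def)
  ultimately have step:
    "(1 - r) / (1 + r) * x + (1 - r) * y \<le> (1 - r) * (x + 2 * c + p) + y - p"
    "(1 + r) * (x + 2 * c + p) + y - p \<le> (1 + r) / (1 - r) * x + (1 + r) * y"
    using potential_step[of c x p r y] r by simp_all
  \<comment> \<open>Regrouping: the summand \<open>X (Suc k)\<close> of \<open>V\<close> is absorbed
    into \<open>T\<close>, which leaves the sum up to \<open>k\<close> of the induction
    hypothesis.\<close>
  have VT: "(\<lambda>x. V x + P x) = (\<lambda>x. (\<Sum>i=1..k. X i x) + T x)"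
    by (simp add: V_def T_def add.assoc)
  have w': "(\<integral>x. ((\<Sum>i=1..Suc k. X i x) + Y x)\<^sup>2 \<partial>M) = w + y - p"
    using second_moment_cond_exp_split[OF F GF H ind V Y]
    unfolding P_def[symmetric] VT[THEN fun_cong] w_def[symmetric] y_def[symmetric] p_def[symmetric]
    by (simp only: V_def)
  have sum: "(\<Sum>i=1..Suc k. \<integral>x. (X i x)\<^sup>2 \<partial>M) = (\<Sum>i=1..k. \<integral>x. (X i x)\<^sup>2 \<partial>M) + x"
    by (simp add: x_def)
  have "k < n" using Suc.prems(1) by simp
  \<comment> \<open>The induction hypothesis bounds \<open>w\<close> with \<open>(1 - r) * t\<close>
    and \<open>(1 + r) * t\<close>, where \<open>t\<close> is \<open>x + 2 * c + p\<close>; adding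
    \<open>y - p\<close> gives the sides estimated in \<open>step\<close>.\<close>
  from Suc.IH[OF this T[unfolded G_def] T0] step show ?case
    unfolding w' sum t w_def[symmetric] y_def[symmetric] distrib_left[of _ _ x] by linarith
qed

theorem proposition13:
  fixes M :: "'a measure" and S :: "'b measure" and n :: nat
    and \<xi> :: "nat \<Rightarrow> 'a \<Rightarrow> 'b" and f :: "nat \<Rightarrow> 'b \<Rightarrow> real" and X :: "nat \<Rightarrow> 'a \<Rightarrow> real"
  assumes "prob_space M"
    and "n \<ge> 1"
    and "markov_process M S n \<xi>"
    and "\<And>k. k \<in> {1..n} \<Longrightarrow> f k \<in> borel_measurable S"
    and "\<And>k \<omega>. k \<in> {1..n} \<Longrightarrow> \<omega> \<in> space M \<Longrightarrow> X k \<omega> = f k (\<xi> k \<omega>)"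
    and "\<And>k. k \<in> {1..n} \<Longrightarrow> integrable M (\<lambda>\<omega>. (X k \<omega>)\<^sup>2)"
    and "\<And>k. k \<in> {1..n} \<Longrightarrow> (\<integral>\<omega>. X k \<omega> \<partial>M) = 0"
    and "rho1 M S n \<xi> < 1"
  shows "(1 - rho1 M S n \<xi>) / (1 + rho1 M S n \<xi>) * (\<Sum>i=1..n. \<integral>\<omega>. (X i \<omega>)\<^sup>2 \<partial>M)
           \<le> (\<integral>\<omega>. (\<Sum>i=1..n. X i \<omega>)\<^sup>2 \<partial>M)
       \<and> (\<integral>\<omega>. (\<Sum>i=1..n. X i \<omega>)\<^sup>2 \<partial>M)
           \<le> (1 + rho1 M S n \<xi>) / (1 - rho1 M S n \<xi>) * (\<Sum>i=1..n. \<integral>\<omega>. (X i \<omega>)\<^sup>2 \<partial>M)"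
proof -
  interpret prob_space M by fact
  define r where "r = rho1 M S n \<xi>"
  have \<xi>: "\<xi> k \<in> measurable M S" if "k \<in> {1..n}" for k
    using assms(3) that by (auto simp: markov_process_def)
  have X: "X k \<in> sq_integrable_rvs M (sigma_rv M S (\<xi> k))" if k: "k \<in> {1..n}" for k
  proof -
    have "(\<lambda>\<omega>. f k (\<xi> k \<omega>)) \<in> borel_measurable (sigma_rv M S (\<xi> k))"
      by (rule measurable_compose[OF measurable_sigma_rv[OF \<xi>[OF k]] assms(4)[OF k]])
    also have "?this \<longleftrightarrow> X k \<in> borel_measurable (sigma_rv M S (\<xi> k))"
      by (rule measurable_cong) (simp add: assms(5)[OF k])
    finally show ?thesis using assms(6)[OF k] by (simp add: sq_integrable_rvs_def)
  qed
  have corr: "max_corr M (sigma_rv M S (\<xi> k)) (sigma_rv M S (\<xi> (k + 1))) \<le> r"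
    if "k \<in> {1..<n}" for k
    using that unfolding r_def rho1_def by (auto intro!: Max_ge)
  \<comment> \<open>For \<open>n = 1\<close> this is the convention in \<open>rho1\<close>;
    otherwise the pair of times 1 and 2 already gives a nonnegative lower bound.\<close>
  have "0 \<le> r"
  proof (cases "n \<le> 1")
    case True
    then show ?thesis by (simp add: r_def rho1_def)
  next
    case False
    then have "0 \<le> max_corr M (sigma_rv M S (\<xi> 1)) (sigma_rv M S (\<xi> (1 + 1)))"
      by (intro max_corr_nonneg subalgebra_sigma_rv \<xi>) auto
    also have "\<dots> \<le> r" using False by (intro corr) auto
    finally show ?thesis .
  qed
  have "r < 1" using assms(8) by (simp add: r_def)
  obtain k where n: "n = Suc k" using assms(2) by (cases n) auto
  define x where "x = (\<integral>\<omega>. (X n \<omega>)\<^sup>2 \<partial>M)"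
  have "x \<ge> 0" by (simp add: x_def)
  \<comment> \<open>The induction result is applied with \<open>Y = X n\<close>, where the last
    summand has the weights \<open>1 - r\<close> and \<open>1 + r\<close>. These are sharper than
    the weights claimed.\<close>
  have le: "(1 - r) / (1 + r) \<le> 1 - r" "1 + r \<le> (1 + r) / (1 - r)"
    using \<open>0 \<le> r\<close> \<open>r < 1\<close> by (auto simp: field_simps mult_left_le)
  have split: "(\<Sum>i=1..n. g i) = (\<Sum>i=1..k. g i) + g n" for g :: "nat \<Rightarrow> real"
    by (simp add: n)
  have "k < n" by (simp add: n)
  have "X n \<in> sq_integrable_rvs M (sigma_rv M S (\<xi> (Suc k)))" "integral\<^sup>L M (X n) = 0"
    using X[of n] assms(7)[of n] by (simp_all add: n)
  from markov_second_moment_bounds[OF assms(3) X assms(7) corr \<open>0 \<le> r\<close> \<open>r < 1\<close> \<open>k < n\<close> this]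
    mult_right_mono[OF le(1) \<open>x \<ge> 0\<close>] mult_right_mono[OF le(2) \<open>x \<ge> 0\<close>]
  show ?thesis
    unfolding split r_def[symmetric] x_def[symmetric] distrib_left[of _ _ x] by linarith
qed

end
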